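(* For every positive integer $n$, the quadruples of statistics $(T_1,T_2,T_3,S_{17})$ and $(T_2,T_1,T_3,S_{17})$ are equidistributed over the symmetric group $\mathfrak S_n$; that is, for all integers $a,b,c,d$, $$\#\{p\in\mathfrak S_n:(T_1,T_2,T_3,S_{17})(p)=(a,b,c,d)\}=\#\{p\in\mathfrak S_n:(T_2,T_1,T_3,S_{17})(p)=(a,b,c,d)\}.$$
   Context: For $p=p_1p_2\cdots p_n\in\mathfrak S_n$ in one-line notation, with $\mathbb O$ and $\mathbb E$ the sets of odd and even positive integers: $T_1(p)=|\{i\in[n-1]:p_i>p_{i+1},\ p_i\in\mathbb O,\ p_{i+1}\in\mathbb E\}|$; $T_2(p)=|\{i\in[n-1]:p_i<p_{i+1}\text{ and }p_i,p_{i+1}\in\mathbb O\}|$; $T_3(p)=|\{i\in[n-1]:p_i>p_{i+1}\text{ and }p_i,p_{i+1}\in\mathbb O\}|$; $S_{17}(p)$ is the largest $i\in[n]$ such that the elements $1,2,\dots,i$ appear in this order from left to right in $p$. *)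

theory Defs
  imports "HOL-Combinatorics.Permutations"
begin

text \<open>
  An element of the symmetric group on \<open>{1..n}\<close> is a function \<open>p\<close> with \<open>p permutes {1..n}\<close>;
  its one-line notation is \<open>p 1, p 2, \<dots>, p n\<close>.
\<close>

definition T1 :: "nat \<Rightarrow> (nat \<Rightarrow> nat) \<Rightarrow> nat" where
  "T1 n p = card {i \<in> {1..n - 1}. p i > p (i + 1) \<and> odd (p i) \<and> even (p (i + 1))}"

definition T2 :: "nat \<Rightarrow> (nat \<Rightarrow> nat) \<Rightarrow> nat" where
  "T2 n p = card {i \<in> {1..n - 1}. p i < p (i + 1) \<and> odd (p i) \<and> odd (p (i + 1))}"

definition T3 :: "nat \<Rightarrow> (nat \<Rightarrow> nat) \<Rightarrow> nat" where
  "T3 n p = card {i \<in> {1..n - 1}. p i > p (i + 1) \<and> odd (p i) \<and> odd (p (i + 1))}"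

text \<open>
  Since \<open>inv p v\<close> is the position of the value \<open>v\<close> in the one-line notation, the values
  \<open>1, \<dots>, i\<close> appear in this order from left to right iff \<open>inv p\<close> is strictly increasing
  on \<open>{1..i}\<close>. For \<open>n \<ge> 1\<close> the set below is finite and contains \<open>1\<close>, so the maximum
  is meaningful.
\<close>

definition S17 :: "nat \<Rightarrow> (nat \<Rightarrow> nat) \<Rightarrow> nat" where
  "S17 n p = Max {i \<in> {1..n}. strict_mono_on {1..i} (inv p)}"

end

theory Submission
  imports Defs "HOL-Combinatorics.Multiset_Permutations"
begin

text \<open>
  Build the one-line words by inserting the values 1, 2, 3, \<dots> in increasing order. How inserting the
  new maximum at a gap changes \<open>(T1, T2, T3)\<close> depends only on the type of the gap (parities and order
  of its two neighbours), and double counting the odd and even letters expresses the number of gaps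
  of each type through \<open>T1, T2, T3\<close> and whether the last letter is odd. Moreover \<open>S17\<close> changes only
  if the word is the identity and the new maximum is appended. So these five quantities evolve as a
  Markov chain, and its transition kernel turns out to be symmetric in \<open>T1\<close> and \<open>T2\<close>.
\<close>

section \<open>Inserting a new maximum, gap by gap\<close>

fun inserts :: "'a \<Rightarrow> 'a list \<Rightarrow> 'a list list" where
  "inserts x [] = [[x]]"
| "inserts x (y # ys) = (x # y # ys) # map ((#) y) (inserts x ys)"

fun adj :: "('a \<Rightarrow> 'a \<Rightarrow> bool) \<Rightarrow> 'a list \<Rightarrow> nat" where
  "adj P (x # y # zs) = of_bool (P x y) + adj P (y # zs)"
| "adj P _ = 0"

definition oe_desc :: "nat \<Rightarrow> nat \<Rightarrow> bool" where
  "oe_desc x y \<longleftrightarrow> x > y \<and> odd x \<and> even y"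
definition oo_asc :: "nat \<Rightarrow> nat \<Rightarrow> bool" where
  "oo_asc x y \<longleftrightarrow> x < y \<and> odd x \<and> odd y"
definition oo_desc :: "nat \<Rightarrow> nat \<Rightarrow> bool" where
  "oo_desc x y \<longleftrightarrow> x > y \<and> odd x \<and> odd y"
text \<open>The last three pair types occur in no statistic, but they are gaps at which an odd
  maximum changes the statistics.\<close>

definition oe_asc :: "nat \<Rightarrow> nat \<Rightarrow> bool" where
  "oe_asc x y \<longleftrightarrow> x < y \<and> odd x \<and> even y"
definition ee :: "nat \<Rightarrow> nat \<Rightarrow> bool" where
  "ee x y \<longleftrightarrow> even x \<and> even y"
definition eo :: "nat \<Rightarrow> nat \<Rightarrow> bool" where
  "eo x y \<longleftrightarrow> even x \<and> odd y"

lemmas gap_defs = oe_desc_def oo_asc_def oo_desc_def oe_asc_def ee_def eo_def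

lemma sum_list_map_inserts_Cons:
  "(\<Sum>zs\<leftarrow>inserts x (y # ys). g zs) = g (x # y # ys) + (\<Sum>zs\<leftarrow>inserts x ys. g (y # zs))"
  by (simp add: o_def)

text \<open>An odd maximum \<open>x\<close> put between \<open>y\<close> and \<open>z\<close>
  creates an \<open>oo_asc\<close> pair on its left iff \<open>y\<close> is odd, and on its right an
  \<open>oe_desc\<close> or \<open>oo_desc\<close> pair according to the parity of \<open>z\<close>,
  while the pair \<open>y\<close>, \<open>z\<close> disappears. The net change is the same for
  \<open>oe_desc\<close> and \<open>oo_desc\<close> gaps, and the same for \<open>oo_asc\<close> and
  \<open>eo\<close> gaps.\<close>

lemma sum_inserts_odd:
  fixes F :: "nat \<Rightarrow> nat \<Rightarrow> nat \<Rightarrow> nat \<Rightarrow> nat"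
  assumes "odd x" "\<forall>y\<in>set (u # xs). y < x" "distinct (u # xs)"
  shows "(\<Sum>zs\<leftarrow>inserts x xs. F (adj oe_desc (u # zs)) (adj oo_asc (u # zs)) (adj oo_desc (u # zs)) (last (u # zs)))
    = (let a = adj oe_desc (u # xs); b = adj oo_asc (u # xs); c = adj oo_desc (u # xs); t = last (u # xs)
       in (a + c) * F a (b + 1) c t
        + adj oe_asc (u # xs) * F (a + 1) (b + 1) c t
        + (b + adj eo (u # xs)) * F a b (c + 1) t
        + adj ee (u # xs) * F (a + 1) b c t
        + F a (b + of_bool (odd t)) c x)"
  using assms(2,3)
proof (induction xs arbitrary: u F)
  case Nil
  then show ?case using assms(1) by (simp add: gap_defs)
next
  case (Cons y ys)
  \<comment> \<open>All insertions to the right of \<open>y\<close> keep the pair \<open>u\<close>,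
    \<open>y\<close>. Its contribution is absorbed into the summed function, so the induction has to
    range over all \<open>F\<close>.\<close>
  let ?G = "\<lambda>a b c. F (of_bool (oe_desc u y) + a) (of_bool (oo_asc u y) + b) (of_bool (oo_desc u y) + c)"
  have IH: "(\<Sum>zs\<leftarrow>inserts x ys. ?G (adj oe_desc (y # zs)) (adj oo_asc (y # zs)) (adj oo_desc (y # zs)) (last (y # zs)))
    = (let a = adj oe_desc (y # ys); b = adj oo_asc (y # ys); c = adj oo_desc (y # ys); t = last (y # ys)
       in (a + c) * ?G a (b + 1) c t
        + adj oe_asc (y # ys) * ?G (a + 1) (b + 1) c t
        + (b + adj eo (y # ys)) * ?G a b (c + 1) t
        + adj ee (y # ys) * ?G (a + 1) b c t
        + ?G a (b + of_bool (odd t)) c x)"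
    by (rule Cons.IH) (use Cons.prems in auto)
  have l: "last (u # y # zs) = last (y # zs)" for zs by simp
  have f: "F (adj oe_desc (u # x # y # ys)) (adj oo_asc (u # x # y # ys)) (adj oo_desc (u # x # y # ys)) (last (u # x # y # ys))
     = F (of_bool (even y) + adj oe_desc (y # ys)) (of_bool (odd u) + adj oo_asc (y # ys)) (of_bool (odd y) + adj oo_desc (y # ys)) (last (y # ys))"
    using Cons.prems assms(1) by (auto simp: gap_defs)
  consider "u < y" | "y < u" using Cons.prems by fastforce
  then show ?case
    unfolding sum_list_map_inserts_Cons f
    unfolding adj.simps l IH Let_def
    by cases (cases "even u"; cases "even y"; simp add: gap_defs algebra_simps)+
qed

lemma adj_gap_bound: "adj oe_desc xs + adj oo_asc xs + adj oo_desc xs \<le> length xs - 1"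
  by (induction oo_asc xs rule: adj.induct) (auto simp: gap_defs)

text \<open>Neither of the pairs formed with an even maximum is counted: on its left is an ascent to
  an even letter, on its right an even source. So the insertion only destroys the counted pair at
  its gap, if there is one. A truncated \<open>a - 1\<close> is harmless because its coefficient is
  then 0.\<close>

lemma sum_inserts_even:
  fixes F :: "nat \<Rightarrow> nat \<Rightarrow> nat \<Rightarrow> nat \<Rightarrow> nat"
  assumes "even x" "\<forall>y\<in>set (u # xs). y < x"
  shows "(\<Sum>zs\<leftarrow>inserts x xs. F (adj oe_desc (u # zs)) (adj oo_asc (u # zs)) (adj oo_desc (u # zs)) (last (u # zs)))
    = (let a = adj oe_desc (u # xs); b = adj oo_asc (u # xs); c = adj oo_desc (u # xs); t = last (u # xs)
       in a * F (a - 1) b c t + b * F a (b - 1) c t + c * F a b (c - 1) t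
        + (length xs - (a + b + c)) * F a b c t + F a b c x)"
  using assms(2)
proof (induction xs arbitrary: u F)
  case Nil
  then show ?case using assms(1) by (simp add: gap_defs)
next
  case (Cons y ys)
  let ?G = "\<lambda>a b c. F (of_bool (oe_desc u y) + a) (of_bool (oo_asc u y) + b) (of_bool (oo_desc u y) + c)"
  have IH: "(\<Sum>zs\<leftarrow>inserts x ys. ?G (adj oe_desc (y # zs)) (adj oo_asc (y # zs)) (adj oo_desc (y # zs)) (last (y # zs)))
    = (let a = adj oe_desc (y # ys); b = adj oo_asc (y # ys); c = adj oo_desc (y # ys); t = last (y # ys)
       in a * ?G (a - 1) b c t + b * ?G a (b - 1) c t + c * ?G a b (c - 1) t
        + (length ys - (a + b + c)) * ?G a b c t + ?G a b c x)"
    by (rule Cons.IH) (use Cons.prems in auto)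
  have l: "last (u # y # zs) = last (y # zs)" for zs by simp
  have f: "F (adj oe_desc (u # x # y # ys)) (adj oo_asc (u # x # y # ys)) (adj oo_desc (u # x # y # ys)) (last (u # x # y # ys))
     = F (adj oe_desc (y # ys)) (adj oo_asc (y # ys)) (adj oo_desc (y # ys)) (last (y # ys))"
    using Cons.prems assms(1) by (auto simp: gap_defs)
  \<comment> \<open>Each gap carries at most one counted pair, so the subtraction giving the number
    of neutral gaps is exact.\<close>
  have bd: "adj oe_desc (y # ys) + adj oo_asc (y # ys) + adj oo_desc (y # ys) \<le> length ys"
    using adj_gap_bound[of "y # ys"] by simp
  consider "oe_desc u y" "\<not> oo_asc u y" "\<not> oo_desc u y" | "\<not> oe_desc u y" "oo_asc u y" "\<not> oo_desc u y"
    | "\<not> oe_desc u y" "\<not> oo_asc u y" "oo_desc u y" | "\<not> oe_desc u y" "\<not> oo_asc u y" "\<not> oo_desc u y"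
    by (auto simp: gap_defs)
  then show ?case
    unfolding sum_list_map_inserts_Cons f
    unfolding adj.simps l IH Let_def
    using bd
    by cases (simp_all add: algebra_simps Suc_diff_le, (metis Suc_pred neq0_conv)+)
qed

section \<open>Arrangements as insertions into smaller arrangements\<close>

lemma append_Cons_in_inserts: "as @ x # bs \<in> set (inserts x (as @ bs))"
  by (induction as) (cases bs; simp)+

lemma in_insertsE:
  assumes "zs \<in> set (inserts x xs)"
  obtains as bs where "zs = as @ x # bs" "xs = as @ bs"
proof -
  have "\<exists>as bs. zs = as @ x # bs \<and> xs = as @ bs"
    using assms
  proof (induction xs arbitrary: zs)
    case (Cons y ys)
    consider "zs = x # y # ys" | zs' where "zs = y # zs'" "zs' \<in> set (inserts x ys)"
      using Cons.prems by auto
    then show ?case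
    proof cases
      case 1
      then have "zs = [] @ x # (y # ys) \<and> y # ys = [] @ (y # ys)" by simp
      then show ?thesis by blast
    next
      case 2
      then obtain as bs where "zs' = as @ x # bs" "ys = as @ bs" using Cons.IH by blast
      then have "zs = (y # as) @ x # bs \<and> y # ys = (y # as) @ bs" using 2 by simp
      then show ?thesis by blast
    qed
  qed simp
  then show thesis using that by blast
qed

lemma distinct_inserts: "x \<notin> set xs \<Longrightarrow> distinct (inserts x xs)"
  by (induction xs) (auto simp: distinct_map)

text \<open>The words are grouped by what remains after deleting \<open>x\<close>; the fibre over
  \<open>xs\<close> consists of the insertions of \<open>x\<close> into \<open>xs\<close>, which are
  pairwise distinct.\<close>

lemma sum_permutations_of_set_insert:
  fixes g :: "'a list \<Rightarrow> 'b::comm_monoid_add"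
  assumes "finite A" "x \<notin> A"
  shows "(\<Sum>zs\<in>permutations_of_set (insert x A). g zs)
    = (\<Sum>xs\<in>permutations_of_set A. \<Sum>zs\<leftarrow>inserts x xs. g zs)"
proof -
  let ?B = "permutations_of_set (insert x A)"
  have fibre: "{zs \<in> ?B. remove1 x zs = xs} = set (inserts x xs)"
    if xs: "xs \<in> permutations_of_set A" for xs
  proof -
    have x: "x \<notin> set xs" "distinct xs" "set xs = A" using xs assms by (auto dest: permutations_of_setD)
    show ?thesis
    proof (intro equalityI subsetI)
      fix zs assume "zs \<in> {zs \<in> ?B. remove1 x zs = xs}"
      then have zs: "distinct zs" "x \<in> set zs" "remove1 x zs = xs"
        by (auto dest: permutations_of_setD)
      then obtain as bs where ab: "zs = as @ x # bs" by (auto dest: split_list)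
      with zs have "xs = as @ bs" by (auto simp: remove1_append)
      then show "zs \<in> set (inserts x xs)" using ab append_Cons_in_inserts by metis
    next
      fix zs assume "zs \<in> set (inserts x xs)"
      then obtain as bs where "zs = as @ x # bs" "xs = as @ bs" by (rule in_insertsE)
      then show "zs \<in> {zs \<in> ?B. remove1 x zs = xs}"
        using x by (auto simp: permutations_of_set_def remove1_append)
    qed
  qed
  have img: "remove1 x ` ?B \<subseteq> permutations_of_set A"
    using assms by (auto simp: permutations_of_set_def set_remove1_eq)
  have "(\<Sum>zs\<in>?B. g zs) = (\<Sum>xs\<in>permutations_of_set A. \<Sum>zs | zs \<in> ?B \<and> remove1 x zs = xs. g zs)"
    by (rule sum.group[symmetric, OF _ _ img]) simp_all
  also have "\<dots> = (\<Sum>xs\<in>permutations_of_set A. \<Sum>zs\<leftarrow>inserts x xs. g zs)"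
  proof (rule sum.cong)
    fix xs assume xs: "xs \<in> permutations_of_set A"
    then have "x \<notin> set xs" using assms by (auto dest: permutations_of_setD)
    then show "(\<Sum>zs | zs \<in> ?B \<and> remove1 x zs = xs. g zs) = (\<Sum>zs\<leftarrow>inserts x xs. g zs)"
      by (simp add: fibre[OF xs] sum.distinct_set_conv_list[OF distinct_inserts])
  qed simp
  finally show ?thesis .
qed

section \<open>The longest initial run of values in order\<close>

text \<open>
  The index 0 is admitted, unlike in \<open>S17\<close>, so that the empty word can start the induction.
\<close>

definition ord_prefix :: "nat list \<Rightarrow> nat" where
  "ord_prefix xs = Max {i \<in> {..length xs}. filter (\<lambda>v. v \<le> i) xs = [1..<Suc i]}"

lemma length_permutation: "xs \<in> permutations_of_set {1..n} \<Longrightarrow> length xs = n"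
  using length_finite_permutations_of_set by fastforce

lemma zero_in_ord_prefix_set:
  assumes "xs \<in> permutations_of_set {1..n}"
  shows "0 \<in> {i \<in> {..length xs}. filter (\<lambda>v. v \<le> i) xs = [1..<Suc i]}"
  using permutations_of_setD[OF assms] by (auto simp: filter_empty_conv)

lemma ord_prefix_in:
  assumes "xs \<in> permutations_of_set {1..n}"
  shows "ord_prefix xs \<in> {i \<in> {..length xs}. filter (\<lambda>v. v \<le> i) xs = [1..<Suc i]}"
  unfolding ord_prefix_def
proof (rule Max_in)
  show "{i \<in> {..length xs}. filter (\<lambda>v. v \<le> i) xs = [1..<Suc i]} \<noteq> {}"
    using zero_in_ord_prefix_set[OF assms] by blast
qed simp

lemma ord_prefix_le:
  assumes "xs \<in> permutations_of_set {1..n}"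
  shows "ord_prefix xs \<le> n"
  using ord_prefix_in[OF assms] unfolding length_permutation[OF assms] by (simp only: mem_Collect_eq atMost_iff)

lemma ord_prefix_eq_iff:
  assumes "xs \<in> permutations_of_set {1..n}"
  shows "ord_prefix xs = n \<longleftrightarrow> xs = [1..<Suc n]"
proof -
  let ?A = "{i \<in> {..length xs}. filter (\<lambda>v. v \<le> i) xs = [1..<Suc i]}"
  have f: "filter (\<lambda>v. v \<le> n) xs = xs"
    using permutations_of_setD[OF assms] by (auto simp: filter_id_conv)
  have iff: "n \<in> ?A \<longleftrightarrow> xs = [1..<Suc n]"
    unfolding length_permutation[OF assms] mem_Collect_eq f
    by (simp only: atMost_iff order_refl simp_thms)
  show ?thesis
  proof
    assume "ord_prefix xs = n"
    with ord_prefix_in[OF assms] show "xs = [1..<Suc n]" using iff by (simp only:)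
  next
    assume "xs = [1..<Suc n]"
    then have "n \<in> ?A" by (rule iff[THEN iffD2])
    then have "n \<le> ord_prefix xs"
      unfolding ord_prefix_def by (rule Max_ge[rotated]) simp
    then show "ord_prefix xs = n"
      using ord_prefix_le[OF assms] by (rule order_antisym[rotated])
  qed
qed

text \<open>For \<open>i \<le> n\<close> the filter discards the new letter, so the admissible
  indices up to \<open>n\<close> are unchanged. The index \<open>Suc n\<close> is admissible only
  for the identity word, which arises only by appending to the identity.\<close>

lemma ord_prefix_inserts:
  assumes xs: "xs \<in> permutations_of_set {1..n}" and zs: "zs \<in> set (inserts (Suc n) xs)"
  shows "ord_prefix zs = (if last (u # zs) = Suc n \<and> ord_prefix xs = n then Suc n else ord_prefix xs)"
proof -
  let ?A = "\<lambda>xs. {i \<in> {..length xs}. filter (\<lambda>v. v \<le> i) xs = [1..<Suc i]}"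
  obtain as bs where ab: "zs = as @ Suc n # bs" "xs = as @ bs"
    using zs by (rule in_insertsE)
  note len = length_permutation[OF xs]
  have sx: "distinct xs" "set xs = {1..n}" using permutations_of_setD[OF xs] by auto
  have new: "Suc n \<notin> set xs" using sx by simp
  have lz: "length zs = Suc n" using ab len by simp
  have fz: "filter (\<lambda>v. v \<le> i) zs = filter (\<lambda>v. v \<le> i) xs" if "i \<le> n" for i
    using that by (simp add: ab)
  have "\<forall>v\<in>set zs. v \<le> Suc n"
  proof -
    have "set zs = insert (Suc n) (set xs)" using ab by auto
    then show ?thesis using sx by auto
  qed
  then have full: "filter (\<lambda>v. v \<le> Suc n) zs = zs"
    by (simp add: filter_id_conv)
  have top: "zs = [1..<Suc (Suc n)] \<longleftrightarrow> last (u # zs) = Suc n \<and> ord_prefix xs = n"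
  proof
    assume zeq: "zs = [1..<Suc (Suc n)]"
    then have "as @ Suc n # bs = [1..<Suc n] @ Suc n # []" using ab by simp
    moreover have "Suc n \<notin> set as" "Suc n \<notin> set bs" using new ab(2) by auto
    ultimately have "as = [1..<Suc n] \<and> bs = []"
      by (subst (asm) append_Cons_eq_iff) auto
    then show "last (u # zs) = Suc n \<and> ord_prefix xs = n"
      using ab ord_prefix_eq_iff[OF xs] by simp
  next
    assume h: "last (u # zs) = Suc n \<and> ord_prefix xs = n"
    then have "xs = [1..<Suc n]" using ord_prefix_eq_iff[OF xs] by simp
    moreover have "bs = []"
    proof (rule ccontr)
      assume "bs \<noteq> []"
      then have "Suc n \<in> set bs" using h ab by (auto dest: last_in_set)
      then show False using new ab(2) by simp
    qed
    ultimately show "zs = [1..<Suc (Suc n)]" using ab by simp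
  qed
  have sets: "?A zs = (if zs = [1..<Suc (Suc n)] then insert (Suc n) (?A xs) else ?A xs)"
    unfolding lz len using fz full
    by (auto simp: le_Suc_eq simp del: upt_Suc)
  have "0 \<in> ?A xs" by (rule zero_in_ord_prefix_set[OF xs])
  then have ne: "?A xs \<noteq> {}" by blast
  show ?thesis
  proof (cases "zs = [1..<Suc (Suc n)]")
    case True
    have "ord_prefix zs = max (Suc n) (ord_prefix xs)"
      unfolding ord_prefix_def sets using True ne by (simp add: Max_insert)
    then show ?thesis using True top ord_prefix_le[OF xs] by simp
  next
    case False
    then show ?thesis unfolding ord_prefix_def sets using top by (auto simp: ord_prefix_def)
  qed
qed

section \<open>Double counting of the gap types\<close>

text \<open>Every odd letter except a final one is the left member of exactly one pair of the four
  types; distinctness excludes equal neighbours.\<close>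

lemma adj_odd_source:
  "distinct xs \<Longrightarrow> adj oe_desc xs + adj oo_asc xs + adj oo_desc xs + adj oe_asc xs
    + of_bool (xs \<noteq> [] \<and> odd (last xs)) = length (filter odd xs)"
  by (induction oo_asc xs rule: adj.induct) (auto simp: gap_defs)

text \<open>Here and in the next lemma, every letter after the head is the right member of exactly
  one pair, classified by the parities and the order of its members.\<close>

lemma adj_even_target:
  "distinct (u # xs) \<Longrightarrow> adj ee (u # xs) + adj oe_desc (u # xs) + adj oe_asc (u # xs) = length (filter even xs)"
  by (induction xs arbitrary: u) (auto simp: gap_defs)

lemma adj_odd_target:
  "distinct (u # xs) \<Longrightarrow> adj eo (u # xs) + adj oo_asc (u # xs) + adj oo_desc (u # xs) = length (filter odd xs)"
  by (induction xs arbitrary: u) (auto simp: gap_defs)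

lemma length_filter_parity:
  assumes "xs \<in> permutations_of_set {1..2 * k}"
  shows "length (filter odd xs) = k" "length (filter even xs) = k"
proof -
  have "length (filter P xs) = length (filter P [1..<Suc (2 * k)])" for P
    using permutations_of_setD[OF assms]
    by (simp add: distinct_length_filter atLeastLessThanSuc_atLeastAtMost del: upt_Suc)
  moreover have "length (filter odd [1..<Suc (2 * k)]) = k" "length (filter even [1..<Suc (2 * k)]) = k"
    by (induction k) auto
  ultimately show "length (filter odd xs) = k" "length (filter even xs) = k" by metis+
qed

section \<open>The transition kernel and its symmetry\<close>

text \<open>
  The sum of \<open>F\<close> over the states reached from a word of length \<open>n\<close> by inserting \<open>n + 1\<close>. The state
  consists of the numbers \<open>a\<close>, \<open>b\<close>, \<open>c\<close> of \<open>oe_desc\<close>, \<open>oo_asc\<close>, \<open>oo_desc\<close> pairs, the truth value of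
  ``the last letter is odd'', and \<open>ord_prefix\<close>; the final summand is the insertion at the end.
  Words are prefixed with a letter 0: as an even letter below all others it creates none of the
  counted pairs, but it turns the front of the word into an ordinary gap.
\<close>

definition insertion_kernel :: "nat \<Rightarrow> (nat \<Rightarrow> nat \<Rightarrow> nat \<Rightarrow> bool \<Rightarrow> nat \<Rightarrow> nat)
    \<Rightarrow> nat \<Rightarrow> nat \<Rightarrow> nat \<Rightarrow> bool \<Rightarrow> nat \<Rightarrow> nat" where
  "insertion_kernel n F a b c l s =
    (let s' = if s = n then Suc n else s; k = n div 2
     in if odd n
        then a * F (a - 1) b c l s + b * F a (b - 1) c l s + c * F a b (c - 1) l s
          + (n - (a + b + c)) * F a b c l s + F a b c False s'
        else (a + c) * F a (b + 1) c l s
          + (k - (a + b + c + of_bool l)) * F (a + 1) (b + 1) c l s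
          + (k - c) * F a b (c + 1) l s
          + (b + c + of_bool l) * F (a + 1) b c l s
          + F a (b + of_bool l) c True s')"

text \<open>For odd \<open>n\<close> the exchange permutes the summands. For even \<open>n\<close>
  the terms to compare are those with \<open>F a (b + 1)\<close> and \<open>F (a + 1) b\<close>,
  with coefficients \<open>a + c\<close> and \<open>b + c + of_bool l\<close>. If \<open>l\<close>
  holds, then \<open>s \<noteq> n\<close> gives \<open>s' = s\<close>, so the insertion at the end
  merges with the former and raises its coefficient to \<open>a + c + 1\<close>.\<close>

lemma insertion_kernel_swap:
  assumes "even n \<Longrightarrow> l \<Longrightarrow> s \<noteq> n"
  shows "insertion_kernel n (\<lambda>a b. F b a) b a c l s = insertion_kernel n F a b c l s"
  using assms by (cases l) (auto simp: insertion_kernel_def Let_def algebra_simps)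

lemma sum_inserts_eq_insertion_kernel:
  assumes xs: "xs \<in> permutations_of_set {1..n}"
  shows "(\<Sum>zs\<leftarrow>inserts (Suc n) xs. F (adj oe_desc (0 # zs)) (adj oo_asc (0 # zs)) (adj oo_desc (0 # zs))
        (odd (last (0 # zs))) (ord_prefix zs))
    = insertion_kernel n F (adj oe_desc (0 # xs)) (adj oo_asc (0 # xs)) (adj oo_desc (0 # xs))
        (odd (last (0 # xs))) (ord_prefix xs)"
proof -
  have sx: "distinct xs" "set xs = {1..n}" using permutations_of_setD[OF xs] by auto
  have dist: "distinct (0 # xs)" using sx by simp
  have small: "\<forall>y\<in>set (0 # xs). y < Suc n" using sx by auto
  have last: "last (0 # xs) \<noteq> Suc n" using small last_in_set[of "0 # xs"] by fastforce
  \<comment> \<open>The new \<open>ord_prefix\<close> is a function of the last letter alone, once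
    \<open>xs\<close> is fixed. By the preceding fact, only the insertion at the end can raise
    it.\<close>
  let ?H = "\<lambda>a b c t. F a b c (odd t) (if t = Suc n \<and> ord_prefix xs = n then Suc n else ord_prefix xs)"
  have "(\<Sum>zs\<leftarrow>inserts (Suc n) xs. F (adj oe_desc (0 # zs)) (adj oo_asc (0 # zs)) (adj oo_desc (0 # zs))
        (odd (last (0 # zs))) (ord_prefix zs))
      = (\<Sum>zs\<leftarrow>inserts (Suc n) xs. ?H (adj oe_desc (0 # zs)) (adj oo_asc (0 # zs)) (adj oo_desc (0 # zs))
        (last (0 # zs)))"
    by (rule arg_cong[where f = sum_list], rule map_cong[OF refl])
       (simp only: ord_prefix_inserts[OF xs, where u = 0])
  also have "\<dots> = insertion_kernel n F (adj oe_desc (0 # xs)) (adj oo_asc (0 # xs)) (adj oo_desc (0 # xs))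
        (odd (last (0 # xs))) (ord_prefix xs)"
  proof (cases "odd n")
    case True
    then have e: "even (Suc n)" by simp
    show ?thesis
      unfolding sum_inserts_even[OF e small, where F = ?H] using last True
      by (simp add: insertion_kernel_def Let_def length_permutation[OF xs])
  next
    case False
    then obtain k where n: "n = 2 * k" by (auto elim: evenE)
    have o: "odd (Suc n)" using False by simp
    note par = length_filter_parity[OF xs[unfolded n]]
    define a b c w where "a = adj oe_desc (0 # xs)" and "b = adj oo_asc (0 # xs)"
      and "c = adj oo_desc (0 # xs)" and "w = adj oe_asc (0 # xs)"
    define l where "l = odd (last (0 # xs))"
    note ds = a_def[symmetric] b_def[symmetric] c_def[symmetric] w_def[symmetric] l_def[symmetric]
    \<comment> \<open>The word has \<open>k\<close> odd and \<open>k\<close> even positive letters.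
      The three counts determine the numbers of \<open>oe_asc\<close>, \<open>ee\<close> and
      \<open>eo\<close> gaps from \<open>a\<close>, \<open>b\<close>, \<open>c\<close> and
      \<open>l\<close>.\<close>
    have 1: "a + b + c + w + of_bool l = k"
      using adj_odd_source[OF dist] par unfolding ds by (simp add: l_def)
    have 2: "adj ee (0 # xs) + a + w = k"
      using adj_even_target[OF dist] par unfolding ds by simp
    have 3: "adj eo (0 # xs) + b + c = k"
      using adj_odd_target[OF dist] par unfolding ds by simp
    have w: "w = k - (a + b + c + of_bool l)" and ee: "adj ee (0 # xs) = b + c + of_bool l"
      and eo: "b + adj eo (0 # xs) = k - c"
      using 1 2 3 by linarith+
    have k: "n div 2 = k" using n by simp
    show ?thesis
      unfolding sum_inserts_odd[OF o small dist, where F = ?H] Let_def ds eo ee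
      unfolding w insertion_kernel_def Let_def k using last False l_def by simp
  qed
  finally show ?thesis .
qed

text \<open>The identity of even length ends in an even letter, the prefixed 0 if
  \<open>n = 0\<close>. This supplies the hypothesis of
  \<open>insertion_kernel_swap\<close>.\<close>

lemma ord_prefix_neq_if_last_odd:
  assumes "xs \<in> permutations_of_set {1..n}" "even n" "odd (last (0 # xs))"
  shows "ord_prefix xs \<noteq> n"
proof
  assume "ord_prefix xs = n"
  then have "xs = [1..<Suc n]" using ord_prefix_eq_iff assms(1) by blast
  then show False using assms(2,3) by (cases n) auto
qed

text \<open>Ranging over all \<open>F\<close> expresses equidistribution of the whole state, and
  lets the induction hypothesis be applied to the kernel of the swapped \<open>F\<close>.\<close>

lemma sum_permutations_swap:
  fixes F :: "nat \<Rightarrow> nat \<Rightarrow> nat \<Rightarrow> bool \<Rightarrow> nat \<Rightarrow> nat"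
  shows "(\<Sum>xs\<in>permutations_of_set {1..n}. F (adj oe_desc (0 # xs)) (adj oo_asc (0 # xs)) (adj oo_desc (0 # xs))
        (odd (last (0 # xs))) (ord_prefix xs))
    = (\<Sum>xs\<in>permutations_of_set {1..n}. F (adj oo_asc (0 # xs)) (adj oe_desc (0 # xs)) (adj oo_desc (0 # xs))
        (odd (last (0 # xs))) (ord_prefix xs))"
proof (induction n arbitrary: F)
  case 0
  then show ?case by simp
next
  case (Suc n)
  let ?P = "permutations_of_set {1..n}"
  have ins: "{1..Suc n} = insert (Suc n) {1..n}" and new: "Suc n \<notin> {1..n}" by auto
  have step: "(\<Sum>xs\<in>permutations_of_set {1..Suc n}. G (adj oe_desc (0 # xs)) (adj oo_asc (0 # xs)) (adj oo_desc (0 # xs))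
        (odd (last (0 # xs))) (ord_prefix xs))
     = (\<Sum>xs\<in>?P. insertion_kernel n G (adj oe_desc (0 # xs)) (adj oo_asc (0 # xs)) (adj oo_desc (0 # xs))
        (odd (last (0 # xs))) (ord_prefix xs))" for G :: "nat \<Rightarrow> nat \<Rightarrow> nat \<Rightarrow> bool \<Rightarrow> nat \<Rightarrow> nat"
    unfolding ins sum_permutations_of_set_insert[OF finite_atLeastAtMost new]
    by (intro sum.cong refl sum_inserts_eq_insertion_kernel)
  have "(\<Sum>xs\<in>?P. insertion_kernel n F (adj oe_desc (0 # xs)) (adj oo_asc (0 # xs)) (adj oo_desc (0 # xs))
        (odd (last (0 # xs))) (ord_prefix xs))
    = (\<Sum>xs\<in>?P. insertion_kernel n (\<lambda>a b. F b a) (adj oo_asc (0 # xs)) (adj oe_desc (0 # xs)) (adj oo_desc (0 # xs))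
        (odd (last (0 # xs))) (ord_prefix xs))"
    by (intro sum.cong refl insertion_kernel_swap[symmetric] ord_prefix_neq_if_last_odd)
  also have "\<dots> = (\<Sum>xs\<in>?P. insertion_kernel n (\<lambda>a b. F b a) (adj oe_desc (0 # xs)) (adj oo_asc (0 # xs)) (adj oo_desc (0 # xs))
        (odd (last (0 # xs))) (ord_prefix xs))"
    by (rule Suc.IH[symmetric])
  finally show ?case
    unfolding step[of F] step[of "\<lambda>a b. F b a"] .
qed

section \<open>Translation between permutations and words\<close>

lemma bij_betw_one_line:
  "bij_betw (\<lambda>p. map p [1..<Suc n]) {p. p permutes {1..n}} (permutations_of_set {1..n})"
proof -
  let ?f = "\<lambda>p. map p [1..<Suc n]"
  have inj: "inj_on ?f {p. p permutes {1..n}}"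
  proof (intro inj_onI ext)
    fix p q x
    assume "p \<in> {p. p permutes {1..n}}" "q \<in> {p. p permutes {1..n}}" and eq: "?f p = ?f q"
    then have "p permutes {1..n}" "q permutes {1..n}" by auto
    moreover have "p x = q x" if "x \<in> {1..n}" using eq that by (simp del: upt_Suc)
    ultimately show "p x = q x" by (cases "x \<in> {1..n}") (auto simp: permutes_not_in)
  qed
  have sub: "?f ` {p. p permutes {1..n}} \<subseteq> permutations_of_set {1..n}"
    by (auto simp: permutations_of_set_def distinct_map atLeastLessThanSuc_atLeastAtMost
        permutes_inj_on permutes_image simp del: upt_Suc)
  \<comment> \<open>Surjectivity follows by counting: both sides have \<open>n!\<close>
    elements.\<close>
  have "card (?f ` {p. p permutes {1..n}}) = card (permutations_of_set {1..n})"
    unfolding card_image[OF inj] by (simp add: card_permutations[OF refl])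
  then have "?f ` {p. p permutes {1..n}} = permutations_of_set {1..n}"
    by (rule card_subset_eq[OF finite_permutations_of_set sub])
  with inj show ?thesis by (simp add: bij_betw_def)
qed

lemma adj_conv_card: "adj P xs = card {i. Suc i < length xs \<and> P (xs ! i) (xs ! Suc i)}"
proof (induction P xs rule: adj.induct)
  case (1 P x y zs)
  let ?A = "{i. Suc i < length (y # zs) \<and> P ((y # zs) ! i) ((y # zs) ! Suc i)}"
  let ?B = "{i. Suc i < length (x # y # zs) \<and> P ((x # y # zs) ! i) ((x # y # zs) ! Suc i)}"
  have "i \<in> ?B \<longleftrightarrow> i \<in> (if P x y then {0} else {}) \<union> Suc ` ?A" for i
    by (cases i) auto
  then have "?B = (if P x y then {0} else {}) \<union> Suc ` ?A"
    by blast
  moreover have "finite ?A" by (rule finite_subset[of _ "{..length zs}"]) auto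
  ultimately show ?case using 1 by (auto simp: card_insert_if card_image)
qed auto

text \<open>The prefixed 0 shifts the list so that index \<open>i\<close> holds \<open>p i\<close>
  for \<open>1 \<le> i \<le> n\<close>; the extra pair at index 0 is excluded by the assumption on
  \<open>P\<close>.\<close>

lemma adj_one_line:
  assumes "\<And>y. \<not> P 0 y"
  shows "adj P (0 # map p [1..<Suc n]) = card {i \<in> {1..n - 1}. P (p i) (p (i + 1))}"
proof -
  let ?xs = "0 # map p [1..<Suc n]"
  have "i \<in> {i. Suc i < length ?xs \<and> P (?xs ! i) (?xs ! Suc i)}
      \<longleftrightarrow> i \<in> {i \<in> {1..n - 1}. P (p i) (p (i + 1))}" for i
    by (cases i) (auto simp: assms simp del: upt_Suc)
  then show ?thesis
    unfolding adj_conv_card by (intro arg_cong[where f = card] set_eqI)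
qed

lemma strict_mono_on_iff_sorted_wrt:
  fixes f :: "nat \<Rightarrow> 'a::order"
  shows "strict_mono_on {m..n} f \<longleftrightarrow> sorted_wrt (<) (map f [m..<Suc n])"
proof
  assume f: "strict_mono_on {m..n} f"
  have "sorted_wrt (\<lambda>r s. f r < f s) [m..<Suc n]"
    by (rule sorted_wrt_mono_rel[OF _ sorted_wrt_upt]) (use f in \<open>auto intro: strict_mono_onD\<close>)
  then show "sorted_wrt (<) (map f [m..<Suc n])"
    unfolding sorted_wrt_map .
next
  assume sorted: "sorted_wrt (<) (map f [m..<Suc n])"
  show "strict_mono_on {m..n} f"
  proof (rule strict_mono_onI)
    fix r s assume rs: "r \<in> {m..n}" "s \<in> {m..n}" "r < s"
    then have "map f [m..<Suc n] ! (r - m) < map f [m..<Suc n] ! (s - m)"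
      by (intro sorted_wrt_nth_less[OF sorted]) auto
    then show "f r < f s"
      using rs by (simp del: upt_Suc)
  qed
qed

text \<open>The list \<open>?js\<close> and the values of \<open>inv p\<close> on
  \<open>1..i\<close> enumerate the same positions, the first in increasing order. A set has only
  one strictly sorted enumeration, so \<open>inv p\<close> increases iff the two lists agree;
  applying \<open>p\<close> then gives the filtered word.\<close>

lemma strict_mono_on_inv_iff:
  assumes p: "p permutes {1..n}" and i: "i \<le> n"
  shows "strict_mono_on {1..i} (inv p) \<longleftrightarrow> filter (\<lambda>v. v \<le> i) (map p [1..<Suc n]) = [1..<Suc i]"
proof -
  let ?js = "filter (\<lambda>j. p j \<le> i) [1..<Suc n]"
  have f: "filter (\<lambda>v. v \<le> i) (map p [1..<Suc n]) = map p ?js"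
    by (simp add: filter_map o_def del: upt_Suc)
  have inv1: "inv p (p j) = j" "p (inv p j) = j" for j using permutes_inverses[OF p] by auto
  have mono: "strict_mono_on {1..i} (inv p) \<longleftrightarrow> sorted_wrt (<) (map (inv p) [1..<Suc i])"
    by (rule strict_mono_on_iff_sorted_wrt)
  have "set ?js = set (map (inv p) [1..<Suc i])"
  proof -
    have "j \<in> inv p ` {1..i}" if "1 \<le> j" "j \<le> n" "p j \<le> i" for j
      using that permutes_in_image[OF p, of j] inv1(1)[of j] by (auto intro!: image_eqI[of _ _ "p j"])
    moreover have "inv p v \<in> {1..n}" if "1 \<le> v" "v \<le> i" for v
      using that i permutes_in_image[OF permutes_inv[OF p], of v] by auto
    ultimately show ?thesis
      using inv1 by (auto simp: atLeastLessThanSuc_atLeastAtMost simp del: upt_Suc)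
  qed
  moreover have "sorted_wrt (<) ?js" by (simp add: sorted_wrt_filter del: upt_Suc)
  ultimately have "sorted_wrt (<) (map (inv p) [1..<Suc i]) \<longleftrightarrow> ?js = map (inv p) [1..<Suc i]"
    by (metis strict_sorted_equal)
  also have "\<dots> \<longleftrightarrow> map p ?js = [1..<Suc i]"
  proof
    assume "?js = map (inv p) [1..<Suc i]"
    then have "map p ?js = map p (map (inv p) [1..<Suc i])" by (simp only:)
    then show "map p ?js = [1..<Suc i]" by (simp add: inv1 o_def del: upt_Suc)
  next
    assume "map p ?js = [1..<Suc i]"
    then have "map (inv p) (map p ?js) = map (inv p) [1..<Suc i]" by (simp only:)
    then show "?js = map (inv p) [1..<Suc i]" by (simp add: inv1 o_def del: upt_Suc)
  qed
  finally show ?thesis unfolding f mono .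
qed

text \<open>The two index sets differ only by 0, which does not affect the maximum since 1 is
  admissible for \<open>n \<ge> 1\<close>.\<close>

lemma S17_conv_ord_prefix:
  assumes p: "p permutes {1..n}" and n: "n \<ge> 1"
  shows "S17 n p = ord_prefix (map p [1..<Suc n])"
proof -
  let ?A = "{i \<in> {1..n}. strict_mono_on {1..i} (inv p)}"
  have one: "1 \<in> ?A" using n by (auto simp: strict_mono_on_def)
  have "map p [1..<Suc n] \<in> permutations_of_set {1..n}"
    using bij_betwE[OF bij_betw_one_line] p by blast
  from zero_in_ord_prefix_set[OF this]
  have sets: "{i \<in> {..length (map p [1..<Suc n])}. filter (\<lambda>v. v \<le> i) (map p [1..<Suc n]) = [1..<Suc i]} = insert 0 ?A"
    using strict_mono_on_inv_iff[OF p] by (auto simp del: upt_Suc simp: not_less_eq_eq Suc_le_eq)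
  have "Max (insert 0 ?A) = Max ?A"
    using one by (subst Max_insert) (auto simp del: One_nat_def)
  then show ?thesis unfolding S17_def ord_prefix_def sets by (rule sym)
qed

theorem theorem1p3:
  fixes n :: nat and a b c d :: int
  assumes "n \<ge> 1"
  shows "card {p. p permutes {1..n} \<and>
             (int (T1 n p), int (T2 n p), int (T3 n p), int (S17 n p)) = (a, b, c, d)} =
         card {p. p permutes {1..n} \<and>
             (int (T2 n p), int (T1 n p), int (T3 n p), int (S17 n p)) = (a, b, c, d)}"
proof -
  let ?P = "{p. p permutes {1..n}}"
  let ?w = "\<lambda>p. map p [1..<Suc n]"
  \<comment> \<open>The indicator of the prescribed values, which sums over both parities of the
    last letter, turns the identity of sums into one of cardinalities.\<close>
  let ?F = "\<lambda>x y z (l::bool) s. of_bool ((int x, int y, int z, int s) = (a, b, c, d)) :: nat"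
  have T: "T1 n p = adj oe_desc (0 # ?w p)" "T2 n p = adj oo_asc (0 # ?w p)" "T3 n p = adj oo_desc (0 # ?w p)" for p
    unfolding T1_def T2_def T3_def
    by (subst adj_one_line; simp add: gap_defs)+
  have fin: "finite ?P" by (simp add: finite_permutations)
  have card: "card {p. p permutes {1..n} \<and> Q p} = (\<Sum>p\<in>?P. of_bool (Q p))" for Q
    using fin by (simp add: Int_def)
  have reindex: "(\<Sum>p\<in>?P. g (?w p)) = (\<Sum>xs\<in>permutations_of_set {1..n}. g xs)" for g :: "nat list \<Rightarrow> nat"
    by (rule sum.reindex_bij_betw[OF bij_betw_one_line])
  have "(\<Sum>p\<in>?P. ?F (T1 n p) (T2 n p) (T3 n p) True (S17 n p))
     = (\<Sum>p\<in>?P. (\<lambda>xs. ?F (adj oe_desc (0 # xs)) (adj oo_asc (0 # xs)) (adj oo_desc (0 # xs)) (odd (last (0 # xs))) (ord_prefix xs)) (?w p))"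
    by (intro sum.cong refl) (simp add: T S17_conv_ord_prefix[OF _ assms] del: upt_Suc)
  also have "\<dots> = (\<Sum>p\<in>?P. (\<lambda>xs. ?F (adj oo_asc (0 # xs)) (adj oe_desc (0 # xs)) (adj oo_desc (0 # xs)) (odd (last (0 # xs))) (ord_prefix xs)) (?w p))"
    using sum_permutations_swap[of ?F n] unfolding reindex[symmetric] .
  also have "\<dots> = (\<Sum>p\<in>?P. ?F (T2 n p) (T1 n p) (T3 n p) True (S17 n p))"
    by (intro sum.cong refl) (simp add: T S17_conv_ord_prefix[OF _ assms] del: upt_Suc)
  finally show ?thesis unfolding card .
qed

end
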